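(* Let $(X,d)$ be a metric space, let $C\subseteq X$ be finite, let $k$ be a positive integer with $k\le |C|$, and let $\lambda>0$ be a real number. Consider the instance $(C,C,k,\lambda)$ of the reconciliation $k$-median problem, in which the facility set and the client set are both equal to $C$. Let $S$ be a solution returned by the LocalSearch algorithm on this instance, and let $O$ be an optimal solution. Assume that for all $s\in S$ and all $o\in O$, $$|N_S(s)|\ge \lceil 2\lambda\rceil k,\qquad |N_O(o)|\ge \lceil 2\lambda\rceil k,\qquad |N_S(s)|=|N_O(o)|.$$ Then $$\mathrm{cost}(S)\;\le\;\max\{11,\,4\lambda\}\,\mathrm{cost}(O).$$
   Context: Reconciliation $k$-median problem: an instance $(F,C,k,\lambda)$ consists of finite subsets $F$ (facilities) and $C$ (clients) of a metric space $(X,d)$, not necessarily disjoint, a positive integer $k$, and a real number $\lambda>0$. A solution is a set $S\subseteq F$ with $|S|=k$. Given a solution $S$, each client $c\in C$ is assigned to exactly one facility of $S$ at minimum distance from $c$ (ties broken arbitrarily), and for $s\in S$, $N_S(s)\subseteq C$ denotes the set of clients assigned to $s$; so $\{N_S(s)\}_{s\in S}$ partitions $C$. The cost of $S$ is $$\mathrm{cost}(S)=\sum_{s\in S}\sum_{c\in N_S(s)} d(c,s)+\frac{\lambda}{2}\sum_{s\in S}\sum_{t\in S} d(s,t),$$ where the last double sum is over all ordered pairs of elements of $S$; the first term equals $\sum_{c\in C}\min_{s\in S}d(c,s)$. An optimal solution is a solution of minimum cost. LocalSearch algorithm: start with an arbitrary (random) set $S\subseteq F$ with $|S|=k$. While there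 exist $s\in S$ and $t\in F\setminus S$ with $\mathrm{cost}((S\setminus\{s\})\cup\{t\})<\mathrm{cost}(S)$, replace $S$ by $(S\setminus\{s\})\cup\{t\}$ for such a pair. When no such pair exists, return $S$. Thus a returned solution $S$ satisfies $\mathrm{cost}((S\setminus\{s\})\cup\{t\})\ge\mathrm{cost}(S)$ for all $s\in S$ and $t\in F\setminus S$. *)

theory Defs
  imports "HOL-Analysis.Abstract_Metric_Spaces"
begin

definition solution :: "'a set \<Rightarrow> nat \<Rightarrow> 'a set \<Rightarrow> bool" where
  "solution F k S \<longleftrightarrow> S \<subseteq> F \<and> card S = k"

text \<open>
  A tie-breaking rule \<open>a\<close> fixes, for every solution \<open>S\<close>, the facility \<open>a S c\<close> serving client \<open>c\<close>.
  The clusters depend on \<open>a\<close>; the cost does not (lemma \<open>cost_eq_Min\<close>).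
\<close>

definition nearest_assignment ::
    "('a \<Rightarrow> 'a \<Rightarrow> real) \<Rightarrow> 'a set \<Rightarrow> 'a set \<Rightarrow> nat \<Rightarrow> ('a set \<Rightarrow> 'a \<Rightarrow> 'a) \<Rightarrow> bool" where
  "nearest_assignment d F C k a \<longleftrightarrow>
     (\<forall>S. solution F k S \<longrightarrow> (\<forall>c\<in>C. is_arg_min (d c) (\<lambda>s. s \<in> S) (a S c)))"

definition cluster :: "'a set \<Rightarrow> ('a set \<Rightarrow> 'a \<Rightarrow> 'a) \<Rightarrow> 'a set \<Rightarrow> 'a \<Rightarrow> 'a set" where
  "cluster C a S s = {c \<in> C. a S c = s}"

definition cost ::
    "('a \<Rightarrow> 'a \<Rightarrow> real) \<Rightarrow> 'a set \<Rightarrow> real \<Rightarrow> ('a set \<Rightarrow> 'a \<Rightarrow> 'a) \<Rightarrow> 'a set \<Rightarrow> real" where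
  "cost d C lam a S =
     (\<Sum>s\<in>S. \<Sum>c\<in>cluster C a S s. d c s) + lam / 2 * (\<Sum>s\<in>S. \<Sum>t\<in>S. d s t)"

definition optimal_solution ::
    "('a \<Rightarrow> 'a \<Rightarrow> real) \<Rightarrow> 'a set \<Rightarrow> 'a set \<Rightarrow> nat \<Rightarrow> real \<Rightarrow> ('a set \<Rightarrow> 'a \<Rightarrow> 'a) \<Rightarrow> 'a set \<Rightarrow> bool" where
  "optimal_solution d F C k lam a S \<longleftrightarrow> is_arg_min (cost d C lam a) (solution F k) S"

definition improving_swap ::
    "('a \<Rightarrow> 'a \<Rightarrow> real) \<Rightarrow> 'a set \<Rightarrow> 'a set \<Rightarrow> real \<Rightarrow> ('a set \<Rightarrow> 'a \<Rightarrow> 'a) \<Rightarrow> 'a set \<Rightarrow> 'a set \<Rightarrow> bool" where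
  "improving_swap d F C lam a S S' \<longleftrightarrow>
     (\<exists>s\<in>S. \<exists>t\<in>F - S. S' = (S - {s}) \<union> {t} \<and> cost d C lam a S' < cost d C lam a S)"

text \<open>
  The possible outputs of the nondeterministic algorithm: some run from some initial solution
  terminates in \<open>S\<close>.
\<close>

definition local_search_output ::
    "('a \<Rightarrow> 'a \<Rightarrow> real) \<Rightarrow> 'a set \<Rightarrow> 'a set \<Rightarrow> nat \<Rightarrow> real \<Rightarrow> ('a set \<Rightarrow> 'a \<Rightarrow> 'a) \<Rightarrow> 'a set \<Rightarrow> bool" where
  "local_search_output d F C k lam a S \<longleftrightarrow>
     (\<exists>S0. solution F k S0 \<and> (improving_swap d F C lam a)\<^sup>*\<^sup>* S0 S) \<and>
     (\<nexists>S'. improving_swap d F C lam a S S')"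

lemma nearest_assignment_exists:
  assumes "finite F" "k > 0"
  shows "\<exists>a. nearest_assignment d F C k a"
proof -
  have "\<exists>s. is_arg_min (d c) (\<lambda>s. s \<in> S) s" if "solution F k S" for S c
  proof -
    have "finite S" "S \<noteq> {}"
      using that assms by (auto simp: solution_def intro: finite_subset)
    then show ?thesis
      by (rule ex_is_arg_min_if_finite)
  qed
  then have "nearest_assignment d F C k (\<lambda>S c. SOME s. is_arg_min (d c) (\<lambda>s. s \<in> S) s)"
    unfolding nearest_assignment_def by (auto intro: someI_ex)
  then show ?thesis
    by blast
qed

lemma cost_eq_Min:
  assumes a: "nearest_assignment d F C k a" and S: "solution F k S"
    and fin: "finite F" "finite C"
  shows "cost d C lam a S =
    (\<Sum>c\<in>C. Min (d c ` S)) + lam / 2 * (\<Sum>s\<in>S. \<Sum>t\<in>S. d s t)"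
proof -
  have finS: "finite S"
    using S fin by (auto simp: solution_def intro: finite_subset)
  have arg: "is_arg_min (d c) (\<lambda>s. s \<in> S) (a S c)" if "c \<in> C" for c
    using a S that by (auto simp: nearest_assignment_def)
  have "(\<Sum>s\<in>S. \<Sum>c\<in>cluster C a S s. d c s) = (\<Sum>s\<in>S. \<Sum>c\<in>{c \<in> C. a S c = s}. d c (a S c))"
    by (simp add: cluster_def)
  also have "\<dots> = (\<Sum>c\<in>C. d c (a S c))"
    using arg by (intro sum.group fin finS) (auto simp: is_arg_min_def)
  also have "\<dots> = (\<Sum>c\<in>C. Min (d c ` S))"
    using arg finS by (intro sum.cong refl Min_eqI[symmetric]) (auto simp: is_arg_min_linorder)
  finally show ?thesis
    by (simp add: cost_def)
qed

lemma local_search_output_solution: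
  assumes "finite F" "local_search_output d F C k lam a S"
  shows "solution F k S"
proof -
  obtain S0 where "solution F k S0" "(improving_swap d F C lam a)\<^sup>*\<^sup>* S0 S"
    using assms by (auto simp: local_search_output_def)
  from this(2,1) show ?thesis
  proof (induction rule: rtranclp_induct)
    case (step T U)
    then obtain s t where *: "s \<in> T" "t \<in> F - T" "U = (T - {s}) \<union> {t}" "T \<subseteq> F" "card T = k"
      by (auto simp: improving_swap_def solution_def)
    moreover have "finite T"
      using * assms by (auto intro: finite_subset)
    moreover have "card T > 0"
      using \<open>finite T\<close> * by (auto simp: card_gt_0_iff)
    ultimately show ?case
      by (auto simp: solution_def)
  qed
qed

end

theory Submission
  imports Defs
begin

text \<open>
  Because all clusters have the same size \<open>m\<close>, the clients form the edges of an \<open>m\<close>-regular bipartite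
  multigraph between \<open>S\<close> and \<open>OPT\<close>, which splits into \<open>m\<close> perfect matchings. Hence some bijection
  \<open>\<pi>\<close> from \<open>S\<close> to \<open>OPT\<close> satisfies \<open>m * (\<Sum>s\<in>S. d s (\<pi> s)) \<le> P + Q\<close>, where \<open>P\<close> and \<open>Q\<close> are the
  connection costs of \<open>S\<close> and \<open>OPT\<close>; by the triangle inequality \<open>\<pi>\<close> may be taken to fix \<open>S \<inter> OPT\<close>, so
  that every swap of \<open>s\<close> for \<open>\<pi> s\<close> is either trivial or admissible.

  Sum the local optimality conditions over these swaps, reassigning a client \<open>c\<close> of \<open>s\<close> that
  belongs to another optimal facility \<open>q\<close> to \<open>\<pi>\<^sup>-\<^sup>1 q\<close>. The connection cost changes by at most
  \<open>3Q - P\<close>, and the reconciliation cost by at most \<open>2 g(OPT) - 2 g(S) + (P + Q) / 2\<close>, where \<open>g\<close> is the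
  reconciliation cost and \<open>m \<ge> 2 \<lambda> k\<close> was used. This gives
  \<open>P + 4 g(S) \<le> 7 Q + 4 g(OPT)\<close>, so that the ratio is in fact at most \<open>7\<close>.
\<close>

section \<open>Hall's marriage theorem\<close>

text \<open>Halmos-Vaughan induction. If some nonempty proper subfamily \<open>A\<close> is tight,
  it is matched inside its neighbourhood and the rest outside. Otherwise every nonempty proper
  subfamily has a spare neighbour, so one index can be matched arbitrarily.\<close>

theorem hall_marriage:
  fixes N :: "'i \<Rightarrow> 'b set"
  assumes "finite I" "\<And>i. i \<in> I \<Longrightarrow> finite (N i)"
    and "\<And>A. A \<subseteq> I \<Longrightarrow> card A \<le> card (\<Union>(N ` A))"
  shows "\<exists>f. inj_on f I \<and> (\<forall>i\<in>I. f i \<in> N i)"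
  using assms
proof (induction "card I" arbitrary: I N rule: less_induct)
  case less
  note fin = less.prems(1,2) and hall = less.prems(3)
  show ?case
  proof (cases "\<exists>A. A \<noteq> {} \<and> A \<subset> I \<and> card (\<Union>(N ` A)) = card A")
    case True
    then obtain A where A: "A \<noteq> {}" "A \<subset> I" "card (\<Union>(N ` A)) = card A"
      by blast
    define M where "M = \<Union>(N ` A)"
    have "finite A"
      using A fin(1) by (auto intro: finite_subset)
    then have fA: "finite A" "finite M"
      using A fin(2) by (auto simp: M_def)
    have "\<exists>f. inj_on f A \<and> (\<forall>i\<in>A. f i \<in> N i)"
      using A fin hall by (intro less.hyps) (auto intro: psubset_card_mono finite_subset)
    then obtain f where f: "inj_on f A" "\<And>i. i \<in> A \<Longrightarrow> f i \<in> N i"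
      by blast
    have "\<exists>g. inj_on g (I - A) \<and> (\<forall>i\<in>I - A. g i \<in> N i - M)"
    proof (rule less.hyps)
      show "card (I - A) < card I"
        using A fin by (intro psubset_card_mono) auto
      fix B assume B: "B \<subseteq> I - A"
      have fB: "finite B"
        using B fin(1) by (auto intro: finite_subset)
      \<comment> \<open>Hall's condition for \<open>B \<union> A\<close>, less the tight count of
        \<open>A\<close>, is Hall's condition for \<open>B\<close> outside \<open>M\<close>.\<close>
      have "card B + card A = card (B \<union> A)"
        using B fB fA by (subst card_Un_disjoint) auto
      also have "\<dots> \<le> card (\<Union>(N ` (B \<union> A)))"
        using A B by (intro hall) auto
      also have "\<Union>(N ` (B \<union> A)) = \<Union>((\<lambda>i. N i - M) ` B) \<union> M"
        by (auto simp: M_def)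
      also have "card \<dots> \<le> card (\<Union>((\<lambda>i. N i - M) ` B)) + card M"
        by (rule card_Un_le)
      finally show "card B \<le> card (\<Union>((\<lambda>i. N i - M) ` B))"
        using A by (simp add: M_def)
    qed (use fin in auto)
    then obtain g where g: "inj_on g (I - A)" "\<And>i. i \<in> I - A \<Longrightarrow> g i \<in> N i - M"
      by blast
    have "f i \<in> M" if "i \<in> A" for i
      using f(2) that by (auto simp: M_def)
    then have "inj_on (\<lambda>i. if i \<in> A then f i else g i) I"
      using f(1) g unfolding inj_on_def by (smt (verit) DiffD2 DiffI)
    moreover have "\<forall>i\<in>I. (if i \<in> A then f i else g i) \<in> N i"
      using f g by auto
    ultimately show ?thesis
      by blast
  next
    case False
    show ?thesis
    proof (cases "I = {}")
      case True
      then show ?thesis by simp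
    next
      case False
      then obtain j where j: "j \<in> I"
        by blast
      have "card {j} \<le> card (\<Union>(N ` {j}))"
        using j by (intro hall) auto
      then obtain x where x: "x \<in> N j"
        by fastforce
      have "\<exists>g. inj_on g (I - {j}) \<and> (\<forall>i\<in>I - {j}. g i \<in> N i - {x})"
      proof (rule less.hyps)
        show "card (I - {j}) < card I"
          using j fin by (intro psubset_card_mono) auto
        fix B assume B: "B \<subseteq> I - {j}"
        show "card B \<le> card (\<Union>((\<lambda>i. N i - {x}) ` B))"
        proof (cases "B = {}")
          case False
          \<comment> \<open>As \<open>B\<close> is not tight, it can afford to lose
            \<open>x\<close>.\<close>
          have "card B \<le> card (\<Union>(N ` B))" "card (\<Union>(N ` B)) \<noteq> card B"
            using B j False \<open>\<nexists>A. A \<noteq> {} \<and> A \<subset> I \<and> card (\<Union>(N ` A)) = card A\<close> hall by auto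
          moreover have "\<Union>((\<lambda>i. N i - {x}) ` B) = \<Union>(N ` B) - {x}"
            by auto
          ultimately show ?thesis
            by (auto simp: card_Diff_singleton_if)
        qed simp
      qed (use fin in auto)
      then obtain g where g: "inj_on g (I - {j})" "\<And>i. i \<in> I - {j} \<Longrightarrow> g i \<in> N i - {x}"
        by blast
      have "inj_on (g(j := x)) I"
        using g unfolding inj_on_def by (smt (verit) DiffD2 DiffI fun_upd_apply insertCI singletonD)
      moreover have "\<forall>i\<in>I. (g(j := x)) i \<in> N i"
        using g x by auto
      ultimately show ?thesis
        by blast
    qed
  qed
qed

section \<open>Perfect matchings in regular bipartite multigraphs\<close>

lemma card_vimage_fibres:
  assumes "finite C" "finite A" "\<And>x. x \<in> A \<Longrightarrow> card {c \<in> C. p c = x} = m"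
  shows "card {c \<in> C. p c \<in> A} = m * card A"
proof -
  have "{c \<in> C. p c \<in> A} = (\<Union>x\<in>A. {c \<in> C. p c = x})"
    by auto
  also have "card \<dots> = (\<Sum>x\<in>A. card {c \<in> C. p c = x})"
    using assms by (intro card_UN_disjoint) auto
  finally show ?thesis
    using assms by simp
qed

text \<open>
  A multigraph is given by its edge set \<open>C\<close> and the endpoint maps \<open>p\<close>, \<open>q\<close>.
\<close>

lemma regular_bipartite_perfect_matching:
  assumes fin: "finite C" "finite S" "finite T"
    and p: "p ` C \<subseteq> S" "\<And>s. s \<in> S \<Longrightarrow> card {c \<in> C. p c = s} = m"
    and q: "q ` C \<subseteq> T" "\<And>t. t \<in> T \<Longrightarrow> card {c \<in> C. q c = t} = m"
    and m: "m > 0"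
  shows "\<exists>M\<subseteq>C. bij_betw p M S \<and> bij_betw q M T"
proof -
  define N where "N s = q ` {c \<in> C. p c = s}" for s
  have NT: "\<Union>(N ` A) \<subseteq> T" for A
    using q(1) by (auto simp: N_def)
  have "card A \<le> card (\<Union>(N ` A))" if "A \<subseteq> S" for A
  proof -
    \<comment> \<open>Double counting: all \<open>m * card A\<close> edges at \<open>A\<close> end
      in its neighbourhood, which meets only \<open>m\<close> edges per vertex.\<close>
    have "m * card A = card {c \<in> C. p c \<in> A}"
      using that fin p(2) by (intro card_vimage_fibres[symmetric]) (auto intro: finite_subset)
    also have "\<dots> \<le> card {c \<in> C. q c \<in> \<Union>(N ` A)}"
      using fin by (intro card_mono) (auto simp: N_def)
    also have "\<dots> = m * card (\<Union>(N ` A))"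
      using fin q(2) NT[of A] by (intro card_vimage_fibres) (auto dest: finite_subset)
    finally show ?thesis
      using m by simp
  qed
  then obtain f where f: "inj_on f S" "\<And>s. s \<in> S \<Longrightarrow> f s \<in> N s"
    using hall_marriage[of S N] fin by (auto simp: N_def)
  \<comment> \<open>Edges may be parallel, so one edge joining \<open>s\<close> to
    \<open>f s\<close> is chosen; these edges form the matching.\<close>
  have "\<forall>s\<in>S. \<exists>c. c \<in> C \<and> p c = s \<and> q c = f s"
    using f(2) by (fastforce simp: N_def)
  then obtain e where e: "\<And>s. s \<in> S \<Longrightarrow> e s \<in> C \<and> p (e s) = s \<and> q (e s) = f s"
    by metis
  have C_eq: "{c \<in> C. p c \<in> S} = C" "{c \<in> C. q c \<in> T} = C"
    using p(1) q(1) by auto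
  have "m * card S = m * card T"
    using card_vimage_fibres[OF fin(1,2) p(2)] card_vimage_fibres[OF fin(1,3) q(2)]
    by (simp add: C_eq)
  then have fS: "f ` S = T"
    using f NT[of S] fin m by (intro card_subset_eq) (auto simp: card_image)
  have "bij_betw p (e ` S) S"
    using e by (auto simp: bij_betw_def inj_on_def image_iff)
  moreover have "bij_betw q (e ` S) T"
  proof -
    have "inj_on q (e ` S)"
      using e f(1) by (auto simp: inj_on_def)
    moreover have "q ` e ` S = T"
      using e fS by (auto simp: image_iff)
    ultimately show ?thesis
      by (simp add: bij_betw_def)
  qed
  ultimately show ?thesis
    using e by (intro exI[of _ "e ` S"]) auto
qed

text \<open>Removing a perfect matching lowers every degree by one, so the edges split into
  \<open>m\<close> matchings; the lightest weighs at most the average.\<close>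

lemma regular_bipartite_light_matching:
  fixes w :: "'s \<Rightarrow> 't \<Rightarrow> real"
  assumes "finite C" "finite S" "finite T"
    and "p ` C \<subseteq> S" "\<And>s. s \<in> S \<Longrightarrow> card {c \<in> C. p c = s} = m"
    and "q ` C \<subseteq> T" "\<And>t. t \<in> T \<Longrightarrow> card {c \<in> C. q c = t} = m"
    and "m > 0"
  shows "\<exists>\<pi>. bij_betw \<pi> S T \<and> m * (\<Sum>s\<in>S. w s (\<pi> s)) \<le> (\<Sum>c\<in>C. w (p c) (q c))"
  using assms
proof (induction m arbitrary: C)
  case 0
  then show ?case by simp
next
  case (Suc m)
  define W where "W \<pi> = (\<Sum>s\<in>S. w s (\<pi> s))" for \<pi>
  obtain M where M: "M \<subseteq> C" "bij_betw p M S" "bij_betw q M T"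
    using regular_bipartite_perfect_matching[of C S T p "Suc m" q] Suc.prems by blast
  have fibre: "card {c \<in> C - M. r c = x} = m"
    if r: "bij_betw r M Y" "x \<in> Y" "card {c \<in> C. r c = x} = Suc m" for r :: "'a \<Rightarrow> 'z" and Y x
  proof -
    obtain e where e: "e \<in> M" "r e = x"
      using r(1,2) unfolding bij_betw_def by blast
    then have "{c \<in> C - M. r c = x} = {c \<in> C. r c = x} - {e}"
      using r(1) M(1) by (auto simp: bij_betw_def inj_on_def)
    moreover have "e \<in> {c \<in> C. r c = x}"
      using e M(1) by blast
    ultimately show ?thesis
      using r(3) by (simp only: card_Diff_singleton diff_Suc_1)
  qed
  define \<pi> where "\<pi> = q \<circ> inv_into M p"
  have \<pi>: "bij_betw \<pi> S T"
    unfolding \<pi>_def using M by (intro bij_betw_trans[OF bij_betw_inv_into])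
  have "W \<pi> = (\<Sum>c\<in>M. w (p c) (\<pi> (p c)))"
    unfolding W_def by (rule sum.reindex_bij_betw[OF M(2), symmetric])
  also have "\<dots> = (\<Sum>c\<in>M. w (p c) (q c))"
    using M(2) by (intro sum.cong) (simp_all add: \<pi>_def bij_betw_def)
  finally have split: "(\<Sum>c\<in>C. w (p c) (q c)) = (\<Sum>c\<in>C - M. w (p c) (q c)) + W \<pi>"
    using sum.subset_diff[OF M(1) Suc.prems(1), of "\<lambda>c. w (p c) (q c)"] by simp
  \<comment> \<open>The induction hypothesis needs positive degree; at degree 0 no edge is left and
    \<open>\<pi>\<close> itself serves.\<close>
  have "\<exists>\<rho>. bij_betw \<rho> S T \<and> m * W \<rho> \<le> (\<Sum>c\<in>C - M. w (p c) (q c))"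
  proof (cases "m = 0")
    case True
    then have "C - M = {}"
      using Suc.prems(1,4) fibre[OF M(2) _ Suc.prems(5)] by (fastforce simp: image_subset_iff)
    then have "(\<Sum>c\<in>C - M. w (p c) (q c)) = 0"
      by (simp only: sum.empty)
    then show ?thesis
      using True \<pi> by auto
  next
    case False
    then show ?thesis
      using Suc.prems fibre[OF M(2)] fibre[OF M(3)] unfolding W_def by (intro Suc.IH) auto
  qed
  then obtain \<rho> where \<rho>: "bij_betw \<rho> S T" "m * W \<rho> \<le> (\<Sum>c\<in>C - M. w (p c) (q c))"
    by blast
  have "m * min (W \<pi>) (W \<rho>) \<le> m * W \<rho>"
    by (intro mult_left_mono) auto
  then have "Suc m * min (W \<pi>) (W \<rho>) \<le> m * W \<rho> + W \<pi>"
    by (simp add: distrib_right min.coboundedI1)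
  then have "Suc m * min (W \<pi>) (W \<rho>) \<le> (\<Sum>c\<in>C. w (p c) (q c))"
    using \<rho>(2) split by linarith
  then show ?case
    using \<pi> \<rho>(1) unfolding W_def min_def by (auto split: if_splits)
qed

section \<open>Bijections between point sets of a metric space\<close>

context Metric_space
begin

text \<open>With \<open>y\<close> the preimage of \<open>x\<close>, the two links from
  \<open>y\<close> to \<open>x\<close> and from \<open>x\<close> to \<open>\<pi> x\<close> are
  replaced by the direct link from \<open>y\<close> to \<open>\<pi> x\<close>, and \<open>x\<close>
  becomes fixed. Neither \<open>x\<close> nor \<open>y\<close> was fixed before, so no fixed point
  is lost.\<close>

lemma uncross_bijection:
  assumes "finite S" "S \<subseteq> M" "T \<subseteq> M" "bij_betw \<pi> S T"
    and x: "x \<in> S" "x \<in> T" "\<pi> x \<noteq> x"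
  shows "\<exists>\<rho>. bij_betw \<rho> S T \<and> (\<Sum>s\<in>S. d s (\<rho> s)) \<le> (\<Sum>s\<in>S. d s (\<pi> s)) \<and>
           card {s \<in> S. \<pi> s = s} < card {s \<in> S. \<rho> s = s}"
proof -
  obtain y where y: "y \<in> S" "\<pi> y = x"
    using assms by (metis bij_betw_iff_bijections)
  have xy: "x \<noteq> y"
    using x y by auto
  define \<rho> where "\<rho> = \<pi>(x := x, y := \<pi> x)"
  have S: "S = insert x (insert y (S - {x, y}))"
    using x y by auto
  have "inj_on \<rho> S"
    using assms(4) x y xy by (auto simp: \<rho>_def bij_betw_def inj_on_def)
  moreover have "\<rho> ` S \<subseteq> T"
    using assms(4) x y by (auto simp: \<rho>_def bij_betw_def)
  ultimately have "bij_betw \<rho> S T"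
    using assms(1,4) by (metis bij_betw_def bij_betw_finite bij_betw_same_card card_image card_subset_eq)
  moreover have "(\<Sum>s\<in>S. d s (\<rho> s)) \<le> (\<Sum>s\<in>S. d s (\<pi> s))"
  proof -
    have in_M: "x \<in> M" "y \<in> M" "\<pi> x \<in> M"
      using assms x y by (auto simp: bij_betw_def)
    have split: "(\<Sum>s\<in>S. d s (h s)) = d x (h x) + (d y (h y) + (\<Sum>s\<in>S - {x, y}. d s (h s)))" for h
      using assms(1) xy by (subst S) (simp add: insert_Diff_if)
    have "(\<Sum>s\<in>S - {x, y}. d s (\<rho> s)) = (\<Sum>s\<in>S - {x, y}. d s (\<pi> s))"
      by (intro sum.cong) (auto simp: \<rho>_def)
    then show ?thesis
      using triangle[OF in_M(2,1,3)] in_M xy y(2) split[of \<rho>] split[of \<pi>] by (simp add: \<rho>_def)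
  qed
  moreover have "card {s \<in> S. \<pi> s = s} < card {s \<in> S. \<rho> s = s}"
    using assms(1) x y xy by (intro psubset_card_mono) (auto simp: \<rho>_def)
  ultimately show ?thesis
    by blast
qed

lemma exists_bijection_fixing_Int:
  assumes "finite S" "S \<subseteq> M" "T \<subseteq> M" "bij_betw \<pi> S T"
  shows "\<exists>\<rho>. bij_betw \<rho> S T \<and> (\<Sum>s\<in>S. d s (\<rho> s)) \<le> (\<Sum>s\<in>S. d s (\<pi> s)) \<and>
           (\<forall>s\<in>S \<inter> T. \<rho> s = s)"
  using assms(4)
\<comment> \<open>Each uncrossing adds a fixed point, and there are at most \<open>card S\<close> of
  them.\<close>
proof (induction "card S - card {s \<in> S. \<pi> s = s}" arbitrary: \<pi> rule: less_induct)
  case less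
  show ?case
  proof (cases "\<forall>s\<in>S \<inter> T. \<pi> s = s")
    case True
    then show ?thesis
      using less.prems by blast
  next
    case False
    then obtain x where "x \<in> S" "x \<in> T" "\<pi> x \<noteq> x"
      by blast
    then obtain \<rho> where \<rho>: "bij_betw \<rho> S T" "(\<Sum>s\<in>S. d s (\<rho> s)) \<le> (\<Sum>s\<in>S. d s (\<pi> s))"
      "card {s \<in> S. \<pi> s = s} < card {s \<in> S. \<rho> s = s}"
      using uncross_bijection[OF assms(1-3) less.prems] by blast
    moreover have "card {s \<in> S. \<rho> s = s} \<le> card S"
      using assms(1) by (intro card_mono) auto
    ultimately show ?thesis
      using less.hyps[of \<rho>] by (meson diff_less_mono2 order_trans less_le_trans)
  qed
qed

section \<open>Swaps and local optimality\<close>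

text \<open>Only pairs containing the exchanged point change, each counted in both orders. Summing
  over \<open>S\<close> instead of \<open>S - {s}\<close> adds \<open>d t s\<close>, which is
  nonnegative.\<close>

lemma double_sum_exchange_le:
  assumes "finite S" "S \<subseteq> M" "s \<in> S" "t \<in> M" "t \<in> S \<Longrightarrow> t = s"
  shows "(\<Sum>u\<in>insert t (S - {s}). \<Sum>v\<in>insert t (S - {s}). d u v) - (\<Sum>u\<in>S. \<Sum>v\<in>S. d u v)
    \<le> 2 * ((\<Sum>u\<in>S. d t u) - (\<Sum>u\<in>S. d s u))"
proof -
  define A where "A = S - {s}"
  have A: "finite A" "A \<subseteq> M" "s \<notin> A" "t \<notin> A" "S = insert s A" "s \<in> M"
    using assms by (auto simp: A_def)
  have split: "(\<Sum>u\<in>insert x A. \<Sum>v\<in>insert x A. d u v) = 2 * (\<Sum>u\<in>A. d x u) + (\<Sum>u\<in>A. \<Sum>v\<in>A. d u v)"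
    if x: "x \<notin> A" "x \<in> M" for x
  proof -
    have "(\<Sum>u\<in>A. d u x) = (\<Sum>u\<in>A. d x u)"
      by (intro sum.cong refl commute)
    then show ?thesis
      using A(1) x by (simp add: sum.distrib)
  qed
  have "(\<Sum>u\<in>S. \<Sum>v\<in>S. d u v) = 2 * (\<Sum>u\<in>A. d s u) + (\<Sum>u\<in>A. \<Sum>v\<in>A. d u v)"
    unfolding A(5) using A(3,6) by (rule split)
  moreover have "(\<Sum>u\<in>S. d s u) = (\<Sum>u\<in>A. d s u)" "(\<Sum>u\<in>A. d t u) \<le> (\<Sum>u\<in>S. d t u)"
    unfolding A(5) using A(1,3,6) by simp_all
  ultimately show ?thesis
    using split[OF A(4) assms(4)] unfolding A_def[symmetric] by (simp del: sum.insert)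
qed

text \<open>
  \<open>p\<close> and \<open>q\<close> assign clients to the facilities of the local and of the optimal solution, and \<open>loc\<close> is
  local optimality with respect to the swaps of \<open>s\<close> for \<open>\<pi> s\<close>, trivial ones included.
\<close>

lemma local_optimum_bound:
  fixes lam :: real and m :: nat
  assumes fin: "finite C" "C \<subseteq> M" and ST: "finite S" "S \<subseteq> M" "finite T" "T \<subseteq> M"
    and p: "\<And>c. c \<in> C \<Longrightarrow> p c \<in> S" "\<And>c s. c \<in> C \<Longrightarrow> s \<in> S \<Longrightarrow> d c (p c) \<le> d c s"
      "\<And>s. s \<in> S \<Longrightarrow> card {c \<in> C. p c = s} = m"
    and q: "\<And>c. c \<in> C \<Longrightarrow> q c \<in> T" "\<And>t. t \<in> T \<Longrightarrow> card {c \<in> C. q c = t} = m"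
    and lam: "0 \<le> lam" "2 * lam * card S \<le> m"
    and \<pi>: "bij_betw \<pi> S T" "\<And>s. s \<in> S \<inter> T \<Longrightarrow> \<pi> s = s"
      "m * (\<Sum>s\<in>S. d s (\<pi> s)) \<le> (\<Sum>c\<in>C. d (p c) (q c))"
    and loc: "\<And>s. s \<in> S \<Longrightarrow>
      (\<Sum>c\<in>C. d c (p c)) + lam / 2 * (\<Sum>u\<in>S. \<Sum>v\<in>S. d u v)
      \<le> (\<Sum>c\<in>C. Min (d c ` insert (\<pi> s) (S - {s}))) +
        lam / 2 * (\<Sum>u\<in>insert (\<pi> s) (S - {s}). \<Sum>v\<in>insert (\<pi> s) (S - {s}). d u v)"
  shows "(\<Sum>c\<in>C. d c (p c)) + 2 * lam * (\<Sum>u\<in>S. \<Sum>v\<in>S. d u v)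
    \<le> 7 * (\<Sum>c\<in>C. d c (q c)) + 2 * lam * (\<Sum>u\<in>T. \<Sum>v\<in>T. d u v)"
proof -
  define P where "P = (\<Sum>c\<in>C. d c (p c))"
  define Q where "Q = (\<Sum>c\<in>C. d c (q c))"
  define D where "D = (\<Sum>s\<in>S. d s (\<pi> s))"
  define RS where "RS = (\<Sum>u\<in>S. \<Sum>v\<in>S. d u v)"
  define RT where "RT = (\<Sum>u\<in>T. \<Sum>v\<in>T. d u v)"
  define \<sigma> where "\<sigma> = inv_into S \<pi>"
  have \<sigma>: "\<sigma> t \<in> S" "\<pi> (\<sigma> t) = t" if "t \<in> T" for t
    using that \<pi>(1) by (auto simp: \<sigma>_def bij_betw_def inv_into_into f_inv_into_f)
  have \<sigma>\<pi>: "\<sigma> (\<pi> s) = s" "\<pi> s \<in> T" if "s \<in> S" for s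
    using that \<pi>(1) by (auto simp: \<sigma>_def bij_betw_def)
  have in_M: "c \<in> M" "p c \<in> M" "q c \<in> M" "\<sigma> (q c) \<in> M" if "c \<in> C" for c
    using that fin ST p(1) q(1) \<sigma>(1) by blast+
  have \<pi>_new: "\<pi> s = s" if "s \<in> S" "\<pi> s \<in> S" for s
    using that \<pi> \<sigma>\<pi> by (metis IntI)

  have "m * D \<le> (\<Sum>c\<in>C. d (p c) (q c))"
    using \<pi>(3) by (simp add: D_def)
  also have "\<dots> \<le> (\<Sum>c\<in>C. d c (p c) + d c (q c))"
    using in_M triangle commute by (intro sum_mono) metis
  finally have mD: "m * D \<le> P + Q"
    by (simp add: P_def Q_def sum.distrib)

  \<comment> \<open>\<open>E c\<close> bounds the extra cost of moving \<open>c\<close> to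
    \<open>\<sigma> (q c)\<close> when \<open>p c\<close> closes, by a detour through
    \<open>q c\<close>.\<close>
  define E where "E c = d c (q c) + d (\<sigma> (q c)) (q c) - d c (p c)" for c
  have move: "Min (d c ` insert (\<pi> s) (S - {s})) - d c (p c)
      \<le> (if q c = \<pi> s then d c (q c) - d c (p c) else 0) + (if p c = s then E c else 0)"
    if s: "s \<in> S" and c: "c \<in> C" for s c
  proof -
    define S' where "S' = insert (\<pi> s) (S - {s})"
    have Min_le_S': "Min (d c ` S') \<le> d c r" if "r \<in> S'" for r
      using that ST by (intro Min_le) (auto simp: S'_def)
    have tri: "d c (\<sigma> (q c)) \<le> d c (q c) + d (\<sigma> (q c)) (q c)"
      using in_M[OF c] triangle commute by metis
    \<comment> \<open>Needed when \<open>q c = \<pi> s\<close> and \<open>p c = s\<close>: both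
      terms of the bound are then present.\<close>
    then have E_nonneg: "0 \<le> E c"
      using p(2)[OF c \<sigma>(1)[OF q(1)[OF c]]] by (simp add: E_def)
    consider "q c = \<pi> s" | "q c \<noteq> \<pi> s" "p c = s" | "q c \<noteq> \<pi> s" "p c \<noteq> s"
      by blast
    then have "Min (d c ` S') - d c (p c)
      \<le> (if q c = \<pi> s then d c (q c) - d c (p c) else 0) + (if p c = s then E c else 0)"
    proof cases
      case 1
      then show ?thesis
        using Min_le_S'[of "q c"] E_nonneg by (simp add: S'_def)
    next
      case 2
      \<comment> \<open>The fallback facility is still open after the swap.\<close>
      have "\<sigma> (q c) \<noteq> s"
        using \<sigma>(2)[OF q(1)[OF c]] 2(1) by auto
      then have "\<sigma> (q c) \<in> S'"
        using \<sigma>(1)[OF q(1)[OF c]] by (simp add: S'_def)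
      then show ?thesis
        using Min_le_S'[of "\<sigma> (q c)"] tri 2 by (simp add: E_def)
    next
      case 3
      then show ?thesis
        using Min_le_S'[of "p c"] p(1) c by (simp add: S'_def)
    qed
    then show ?thesis
      by (simp add: S'_def)
  qed

  have "0 \<le> (\<Sum>c\<in>C. (if q c = \<pi> s then d c (q c) - d c (p c) else 0) + (if p c = s then E c else 0))
      + lam * ((\<Sum>u\<in>S. d (\<pi> s) u) - (\<Sum>u\<in>S. d s u))" if s: "s \<in> S" for s
  proof -
    let ?S' = "insert (\<pi> s) (S - {s})"
    have "lam / 2 * ((\<Sum>u\<in>?S'. \<Sum>v\<in>?S'. d u v) - RS)
        \<le> lam / 2 * (2 * ((\<Sum>u\<in>S. d (\<pi> s) u) - (\<Sum>u\<in>S. d s u)))"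
      unfolding RS_def using lam(1) s ST \<sigma>\<pi>(2)[OF s] \<pi>_new[OF s]
      by (intro mult_left_mono double_sum_exchange_le) auto
    moreover have "(\<Sum>c\<in>C. Min (d c ` ?S') - d c (p c))
      \<le> (\<Sum>c\<in>C. (if q c = \<pi> s then d c (q c) - d c (p c) else 0) + (if p c = s then E c else 0))"
      using move[OF s] by (intro sum_mono)
    ultimately show ?thesis
      using loc[OF s] unfolding RS_def[symmetric] by (simp add: sum_subtractf algebra_simps)
  qed
  then have "0 \<le> (\<Sum>s\<in>S. (\<Sum>c\<in>C. (if q c = \<pi> s then d c (q c) - d c (p c) else 0)
        + (if p c = s then E c else 0)) + lam * ((\<Sum>u\<in>S. d (\<pi> s) u) - (\<Sum>u\<in>S. d s u)))"
    by (intro sum_nonneg)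
  also have "\<dots> = (\<Sum>s\<in>S. \<Sum>c\<in>C. (if q c = \<pi> s then d c (q c) - d c (p c) else 0)
        + (if p c = s then E c else 0)) + lam * ((\<Sum>s\<in>S. \<Sum>u\<in>S. d (\<pi> s) u) - RS)"
    by (simp add: sum.distrib sum_subtractf sum_distrib_left[symmetric] RS_def)
  also have "(\<Sum>s\<in>S. \<Sum>c\<in>C. (if q c = \<pi> s then d c (q c) - d c (p c) else 0)
        + (if p c = s then E c else 0)) = (\<Sum>c\<in>C. d c (q c) - d c (p c) + E c)"
  proof (subst sum.swap, intro sum.cong refl)
    fix c assume c: "c \<in> C"
    \<comment> \<open>Over all swaps, each client gains its optimal facility once, at
      \<open>s = \<sigma> (q c)\<close>, and loses its own once, at \<open>s = p c\<close>.\<close>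
    have "(\<Sum>s\<in>S. if q c = \<pi> s then d c (q c) - d c (p c) else 0)
        = (\<Sum>s\<in>S. if s = \<sigma> (q c) then d c (q c) - d c (p c) else 0)"
      using \<sigma> \<sigma>\<pi> q(1)[OF c] by (intro sum.cong) auto
    then show "(\<Sum>s\<in>S. (if q c = \<pi> s then d c (q c) - d c (p c) else 0)
        + (if p c = s then E c else 0)) = d c (q c) - d c (p c) + E c"
      using ST(1) \<sigma>(1)[OF q(1)[OF c]] p(1)[OF c] by (simp add: sum.distrib)
  qed
  also have "\<dots> = 2 * Q - 2 * P + (\<Sum>c\<in>C. d (\<sigma> (q c)) (q c))"
    by (simp add: E_def P_def Q_def sum.distrib sum_subtractf sum_distrib_left[symmetric])
  also have "(\<Sum>c\<in>C. d (\<sigma> (q c)) (q c)) = m * D"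
  proof -
    have "(\<Sum>c\<in>C. d (\<sigma> (q c)) (q c)) = (\<Sum>t\<in>T. \<Sum>c\<in>{c \<in> C. q c = t}. d (\<sigma> (q c)) (q c))"
      using fin(1) ST(3) q(1) by (intro sum.group[symmetric]) auto
    also have "\<dots> = (\<Sum>t\<in>T. m * d (\<sigma> t) t)"
      using q(2) by (intro sum.cong) auto
    also have "\<dots> = (\<Sum>s\<in>S. m * d (\<sigma> (\<pi> s)) (\<pi> s))"
      by (rule sum.reindex_bij_betw[OF \<pi>(1), symmetric])
    also have "\<dots> = m * D"
      using \<sigma>\<pi>(1) by (simp add: D_def sum_distrib_left)
    finally show ?thesis .
  qed
  finally have key: "0 \<le> 2 * Q - 2 * P + m * D + lam * ((\<Sum>s\<in>S. \<Sum>u\<in>S. d (\<pi> s) u) - RS)" .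

  \<comment> \<open>Moving \<open>u\<close> to \<open>\<pi> u\<close> turns the mixed distances into
    those within \<open>T\<close>, at a total price of \<open>card S * D\<close>.\<close>
  have "(\<Sum>s\<in>S. \<Sum>u\<in>S. d (\<pi> s) u) \<le> (\<Sum>s\<in>S. \<Sum>u\<in>S. d (\<pi> s) (\<pi> u) + d u (\<pi> u))"
    using \<sigma>\<pi>(2) ST triangle commute by (intro sum_mono) (metis subsetD)
  also have "\<dots> = (\<Sum>s\<in>S. \<Sum>u\<in>S. d (\<pi> s) (\<pi> u)) + card S * D"
    by (simp add: sum.distrib D_def)
  also have "(\<Sum>s\<in>S. \<Sum>u\<in>S. d (\<pi> s) (\<pi> u)) = (\<Sum>s\<in>S. \<Sum>v\<in>T. d (\<pi> s) v)"
    by (intro sum.cong refl sum.reindex_bij_betw[OF \<pi>(1)])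
  also have "\<dots> = RT"
    unfolding RT_def by (rule sum.reindex_bij_betw[OF \<pi>(1)])
  finally have "lam * (\<Sum>s\<in>S. \<Sum>u\<in>S. d (\<pi> s) u) \<le> lam * (RT + card S * D)"
    using lam(1) by (rule mult_left_mono)
  moreover have "2 * lam * card S * D \<le> m * D"
    using lam(2) by (intro mult_right_mono) (simp_all add: D_def sum_nonneg)
  \<comment> \<open>The terms in \<open>D\<close> total at most \<open>3/2 * m * D\<close>, hence
    \<open>3/2 * (P + Q)\<close>; doubling \<open>key\<close> then gives the coefficients 7 and
    -1.\<close>
  ultimately have "0 \<le> 7 * Q - P + 2 * lam * RT - 2 * lam * RS"
    using key mD by (simp add: algebra_simps)
  then show ?thesis
    by (simp add: P_def Q_def RS_def RT_def)
qed

end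


section \<open>Assembling the approximation bound\<close>

theorem theorem3:
  fixes X :: "'a set" and d :: "'a \<Rightarrow> 'a \<Rightarrow> real" and C :: "'a set"
    and k :: nat and lam :: real and a :: "'a set \<Rightarrow> 'a \<Rightarrow> 'a" and S OPT :: "'a set"
  assumes "Metric_space X d"
    and "C \<subseteq> X" and "finite C"
    and "0 < k" and "k \<le> card C"
    and "0 < lam"
    and "nearest_assignment d C C k a"
    and "local_search_output d C C k lam a S"
    and "optimal_solution d C C k lam a OPT"
    and "\<And>s q. s \<in> S \<Longrightarrow> q \<in> OPT \<Longrightarrow>
           int (card (cluster C a S s)) \<ge> \<lceil>2 * lam\<rceil> * int k \<and>
           int (card (cluster C a OPT q)) \<ge> \<lceil>2 * lam\<rceil> * int k \<and>
           card (cluster C a S s) = card (cluster C a OPT q)"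
  shows "cost d C lam a S \<le> max 11 (4 * lam) * cost d C lam a OPT"
proof -
  interpret Metric_space X d by fact
  have sol: "solution C k S" "solution C k OPT"
    using local_search_output_solution assms by (auto simp: optimal_solution_def is_arg_min_def)
  have S: "finite S" "S \<subseteq> X" "S \<subseteq> C" "card S = k"
    and O: "finite OPT" "OPT \<subseteq> X" "card OPT = k"
    using sol assms(2,3) by (auto simp: solution_def intro: finite_subset)
  obtain s0 q0 where s0: "s0 \<in> S" and q0: "q0 \<in> OPT"
    using S O \<open>0 < k\<close> by fastforce
  define m where "m = card (cluster C a S s0)"
  have mS: "card {c \<in> C. a S c = s} = m" if "s \<in> S" for s
    using assms(10)[OF that q0] assms(10)[OF s0 q0] by (simp add: m_def cluster_def)
  have mO: "card {c \<in> C. a OPT c = q} = m" if "q \<in> OPT" for q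
    using assms(10)[OF s0 that] by (simp add: m_def cluster_def)
  have near: "a T c \<in> T" "\<And>s. s \<in> T \<Longrightarrow> d c (a T c) \<le> d c s"
    if "solution C k T" "c \<in> C" for T c
    using assms(7) that by (auto simp: nearest_assignment_def is_arg_min_linorder)
  have cost_eq: "cost d C lam a T = (\<Sum>c\<in>C. d c (a T c)) + lam / 2 * (\<Sum>u\<in>T. \<Sum>v\<in>T. d u v)"
    if T: "solution C k T" for T
  proof -
    have "finite T"
      using T assms(3) by (auto simp: solution_def intro: finite_subset)
    then have "(\<Sum>c\<in>C. Min (d c ` T)) = (\<Sum>c\<in>C. d c (a T c))"
      using near[OF T] by (intro sum.cong refl Min_eqI) auto
    then show ?thesis
      using cost_eq_Min[OF assms(7) T] assms(3) by simp
  qed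

  have "0 < \<lceil>2 * lam\<rceil> * int k"
    using assms(4,6) by simp
  then have m: "\<lceil>2 * lam\<rceil> * int k \<le> int m" "m > 0"
    using assms(10)[OF s0 q0] by (simp_all add: m_def)
  have "2 * lam * k \<le> \<lceil>2 * lam\<rceil> * real k"
    by (intro mult_right_mono) auto
  also have "\<dots> \<le> m"
    using m(1) by (metis of_int_le_iff of_int_mult of_int_of_nat_eq)
  finally have lam_k: "2 * lam * card S \<le> m"
    using S(4) by simp

  have "\<exists>\<pi>. bij_betw \<pi> S OPT \<and> m * (\<Sum>s\<in>S. d s (\<pi> s)) \<le> (\<Sum>c\<in>C. d (a S c) (a OPT c))"
    using assms(3) S O mS mO m(2) near sol
    by (intro regular_bipartite_light_matching) auto
  then obtain \<pi>0 where \<pi>0: "bij_betw \<pi>0 S OPT"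
      "m * (\<Sum>s\<in>S. d s (\<pi>0 s)) \<le> (\<Sum>c\<in>C. d (a S c) (a OPT c))"
    by blast
  obtain \<pi> where \<pi>: "bij_betw \<pi> S OPT" "\<And>s. s \<in> S \<inter> OPT \<Longrightarrow> \<pi> s = s"
      "(\<Sum>s\<in>S. d s (\<pi> s)) \<le> (\<Sum>s\<in>S. d s (\<pi>0 s))"
    using exists_bijection_fixing_Int[OF S(1,2) O(2) \<pi>0(1)] by blast
  have \<pi>_light: "m * (\<Sum>s\<in>S. d s (\<pi> s)) \<le> (\<Sum>c\<in>C. d (a S c) (a OPT c))"
    using mult_left_mono[OF \<pi>(3), of m] \<pi>0(2) by simp

  have loc: "(\<Sum>c\<in>C. d c (a S c)) + lam / 2 * (\<Sum>u\<in>S. \<Sum>v\<in>S. d u v)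
      \<le> (\<Sum>c\<in>C. Min (d c ` insert (\<pi> s) (S - {s}))) +
        lam / 2 * (\<Sum>u\<in>insert (\<pi> s) (S - {s}). \<Sum>v\<in>insert (\<pi> s) (S - {s}). d u v)"
    if s: "s \<in> S" for s
  proof -
    have \<pi>s: "\<pi> s \<in> OPT" "\<pi> s \<in> C"
      using \<pi>(1) s sol(2) by (auto simp: bij_betw_def solution_def)
    \<comment> \<open>If \<open>\<pi> s\<close> lies in \<open>S\<close>, then \<pi> fixes it, and
      injectivity forces \<open>\<pi> s = s\<close>; the swap is trivial.\<close>
    have fixed: "\<pi> s = s" if "\<pi> s \<in> S"
      using \<pi>(1) \<pi>(2)[of "\<pi> s"] \<pi>s(1) s that by (auto simp: bij_betw_def inj_on_def)
    have "cost d C lam a S \<le> cost d C lam a (insert (\<pi> s) (S - {s}))"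
    proof (cases "\<pi> s \<in> S")
      case True
      then show ?thesis
        using fixed s by (simp add: insert_absorb)
    next
      case False
      have "insert (\<pi> s) (S - {s}) = (S - {s}) \<union> {\<pi> s}"
        by simp
      then have "improving_swap d C C lam a S (insert (\<pi> s) (S - {s}))"
        if "cost d C lam a (insert (\<pi> s) (S - {s})) < cost d C lam a S"
        unfolding improving_swap_def using s \<pi>s(2) False that by blast
      then show ?thesis
        using assms(8) unfolding local_search_output_def by (meson not_le)
    qed
    moreover have "solution C k (insert (\<pi> s) (S - {s}))"
      using S s \<pi>s fixed assms(4) by (auto simp: solution_def card_insert_if)
    ultimately show ?thesis
      using cost_eq[OF sol(1)] cost_eq_Min[OF assms(7)] assms(3) by simp
  qed

  have bound: "(\<Sum>c\<in>C. d c (a S c)) + 2 * lam * (\<Sum>u\<in>S. \<Sum>v\<in>S. d u v)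
      \<le> 7 * (\<Sum>c\<in>C. d c (a OPT c)) + 2 * lam * (\<Sum>u\<in>OPT. \<Sum>v\<in>OPT. d u v)"
    using near[OF sol(1)] near[OF sol(2)] mS mO lam_k assms(6)
    by (intro local_optimum_bound[OF assms(3,2) S(1,2) O(1,2) _ _ _ _ _ _ _ \<pi>(1,2) \<pi>_light loc]) auto

  have pos: "0 \<le> lam * (\<Sum>u\<in>T. \<Sum>v\<in>T. d u v)" "0 \<le> (\<Sum>c\<in>C. d c (a T c))" for T
    using assms(6) by (simp_all add: sum_nonneg)
  \<comment> \<open>Nonnegativity of the reconciliation terms lets the coefficient
    \<open>2 * lam\<close> shrink to \<open>lam / 2\<close> on the left and grow to
    \<open>7 * lam / 2\<close> on the right.\<close>
  have "cost d C lam a S \<le> 7 * cost d C lam a OPT"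
    using bound pos(1)[of S] pos(1)[of OPT] by (simp add: cost_eq[OF sol(1)] cost_eq[OF sol(2)])
  also have "\<dots> \<le> max 11 (4 * lam) * cost d C lam a OPT"
    using pos[of OPT] by (intro mult_right_mono) (simp_all add: cost_eq[OF sol(2)])
  finally show ?thesis .
qed

end
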